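(* Let $d\ge2$, $t\ge2$, let $X=\{x_1,\ldots,x_N\}\subset\mathbb S^{d-1}$ be a node-transitive spherical $t$-design whose Steiner-normalized Minkowski polytope $P_X$ satisfies $P_X^\circ=cUP_X$ for some $c>0$ and $U\in O(d)$. Let $h$ be the common value of $h_{P_X}(x_i)$, let $r=h$, $R=1/(ch)$ and $\alpha:=ch^2=r/R$. Let $F_i$ be the facet of $P_X$ with outer normal $x_i$ and $y_j=\frac1{ch}U^Tx_j$ ($1\le j\le N$) the vertices of $P_X$. Then $$\alpha=\max_{1\le j\le N}\langle Ux_i,x_j\rangle\qquad\text{for every }i.$$ Moreover, for all $i,j$, $$y_j\in F_i\iff\langle Ux_i,x_j\rangle=\alpha.$$
   Context: $\sigma$ is the normalized (probability) surface measure on the unit sphere $\mathbb S^{d-1}\subset\mathbb R^d$, and $\omega_{d-1}$ is the total $(d-1)$-area of $\mathbb S^{d-1}$. A finite set $X=\{x_1,\ldots,x_N\}\subset\mathbb S^{d-1}$ of $N$ distinct points is a spherical $t$-design if $\frac1N\sum_i p(x_i)=\int p\,d\sigma$ for every polynomial $p$ of total degree at most $t$. It is node-transitive if some subgroup $G\le O(d)$ preserves $X$ and acts transitively on it. For $t\ge2$, the Minkowski polytope $P_X\subset\mathbb R^d$ is the full-dimensional convex polytope, unique up to translation, whose surface area measure is $\frac{\omega_{d-1}}N\sum_i\delta_{x_i}$: it has exactly $N$ facets, with outer unit normals $x_1,\ldots,x_N$, each of $(d-1)$-area $\omega_{d-1}/N$. It is Steiner-normalized: the translate is chosen so that the Steiner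 point $d\int_{\mathbb S^{d-1}}h_{P_X}(u)u\,d\sigma(u)$ is $0$, which implies $0\in\operatorname{int}P_X$. Here $h_P(u)=\max_{y\in P}\langle u,y\rangle$ is the support function and $P^\circ=\{z:\langle z,y\rangle\le1\ \forall y\in P\}$ is the polar. For node-transitive $X$ all support numbers $h_{P_X}(x_i)$ are equal, to $h$ say; under $P_X^\circ=cUP_X$ the vertices of $P_X$ are exactly the points $y_j=\frac1{ch}U^Tx_j$, all of norm $R=1/(ch)$ (the centered circumradius), and all facet hyperplanes have distance $r=h$ from the origin (the centered inradius). *)

theory Defs
  imports "HOL-Analysis.Analysis" "HOL-Algebra.Group"
begin

section \<open>Area and the normalized surface measure\<close>

text \<open>
  \<open>hausdorff k\<close> is the \<open>k\<close>-dimensional Hausdorff outer measure, with the constant that makes it agree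
  with Lebesgue measure in dimension \<open>k\<close>. Boundedness of the covering sets is required because
  \<^const>\<open>diameter\<close> is meaningless for unbounded sets, and empty covering sets are singled out because
  \<open>0 ^ 0 = 1\<close>.
\<close>

definition hausdorff_pre :: "nat \<Rightarrow> real \<Rightarrow> 'a::metric_space set \<Rightarrow> ennreal" where
  "hausdorff_pre k \<delta> A =
     (INF C \<in> {C :: nat \<Rightarrow> 'a set. A \<subseteq> (\<Union>n. C n) \<and> (\<forall>n. bounded (C n) \<and> diameter (C n) \<le> \<delta>)}.
        \<Sum>n. if C n = {} then 0
            else ennreal (unit_ball_vol (real k) * (diameter (C n) / 2) ^ k))"

definition hausdorff :: "nat \<Rightarrow> 'a::metric_space set \<Rightarrow> ennreal" where
  "hausdorff k A = (SUP \<delta>\<in>{0<..}. hausdorff_pre k \<delta> A)"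

text \<open>
  As a metric outer measure, \<open>hausdorff k\<close> is countably additive on Borel sets, so the
  following measure assigns \<open>hausdorff k A\<close> to every Borel set \<open>A\<close>.
\<close>

definition hausdorff_measure :: "nat \<Rightarrow> 'a::metric_space measure" where
  "hausdorff_measure k = measure_of UNIV (sets borel) (hausdorff k)"

definition area :: "(real^'n) set \<Rightarrow> ennreal" where
  "area A = hausdorff (CARD('n) - 1) A"

text \<open>The measure \<open>\<sigma>\<close>, regarded as a Borel measure on the whole space concentrated on the sphere.\<close>

definition sphere_measure :: "(real^'n) measure" where
  "sphere_measure = uniform_measure (hausdorff_measure (CARD('n) - 1)) (sphere 0 1)"

section \<open>Spherical designs\<close>

definition polynomial_of_degree_le :: "nat \<Rightarrow> (real^'n \<Rightarrow> real) \<Rightarrow> bool" where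
  "polynomial_of_degree_le t p \<longleftrightarrow>
     (\<exists>a :: ('n \<Rightarrow> nat) \<Rightarrow> real.
        p = (\<lambda>x. \<Sum>m\<in>{m. (\<Sum>i\<in>UNIV. m i) \<le> t}. a m * (\<Prod>i\<in>UNIV. (x $ i) ^ m i)))"

text \<open>The index set of this sum is finite, so the sum does not degenerate to \<open>0\<close>.\<close>

lemma finite_exponents: "finite {m :: 'n::finite \<Rightarrow> nat. (\<Sum>i\<in>UNIV. m i) \<le> t}"
proof (rule finite_subset)
  show "{m :: 'n \<Rightarrow> nat. (\<Sum>i\<in>UNIV. m i) \<le> t} \<subseteq> PiE UNIV (\<lambda>_. {..t})"
  proof
    fix m :: "'n \<Rightarrow> nat"
    assume m: "m \<in> {m. (\<Sum>i\<in>UNIV. m i) \<le> t}"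
    have "m i \<le> t" for i
      using member_le_sum[of i UNIV m] m by simp
    then show "m \<in> PiE UNIV (\<lambda>_. {..t})" by auto
  qed
  show "finite (PiE UNIV (\<lambda>_ :: 'n. {..t}))" by (intro finite_PiE) auto
qed

definition spherical_design :: "nat \<Rightarrow> (real^'n) set \<Rightarrow> bool" where
  "spherical_design t X \<longleftrightarrow>
     finite X \<and> X \<subseteq> sphere 0 1 \<and>
     (\<forall>p. polynomial_of_degree_le t p \<longrightarrow>
        1 / real (card X) * (\<Sum>x\<in>X. p x) = (LINT u|sphere_measure. p u))"

definition orthogonal_group :: "(real^'n^'n) monoid" where
  "orthogonal_group = \<lparr>carrier = {A. orthogonal_matrix A}, mult = (**), one = mat 1\<rparr>"

definition node_transitive :: "(real^'n) set \<Rightarrow> bool" where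
  "node_transitive X \<longleftrightarrow>
     (\<exists>G. subgroup G orthogonal_group \<and>
        (\<forall>g\<in>G. (*v) g ` X = X) \<and>
        (\<forall>x\<in>X. \<forall>y\<in>X. \<exists>g\<in>G. g *v x = y))"

section \<open>Minkowski polytopes\<close>

text \<open>For compact nonempty \<open>P\<close> the supremum is a maximum.\<close>

definition support_fun :: "(real^'n) set \<Rightarrow> real^'n \<Rightarrow> real" where
  "support_fun P u = (SUP y\<in>P. u \<bullet> y)"

definition polar :: "(real^'n) set \<Rightarrow> (real^'n) set" where
  "polar P = {z. \<forall>y\<in>P. z \<bullet> y \<le> 1}"

definition face_in_direction :: "(real^'n) set \<Rightarrow> real^'n \<Rightarrow> (real^'n) set" where
  "face_in_direction P u = {y \<in> P. u \<bullet> y = support_fun P u}"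

definition facet_normals :: "(real^'n) set \<Rightarrow> (real^'n) set" where
  "facet_normals P = {u. norm u = 1 \<and> face_in_direction P u facet_of P}"

text \<open>\<open>dirac_comb A w\<close> is the Borel measure \<open>\<Sum>u\<in>A. w u \<cdot> \<delta>\<^sub>u\<close>.\<close>

definition dirac_comb :: "(real^'n) set \<Rightarrow> (real^'n \<Rightarrow> ennreal) \<Rightarrow> (real^'n) measure" where
  "dirac_comb A w = distr (point_measure A w) borel (\<lambda>u. u)"

text \<open>
  The surface area measure of a full-dimensional polytope: each outer unit facet normal carries
  the area of its facet.
\<close>

definition surface_area_measure :: "(real^'n) set \<Rightarrow> (real^'n) measure" where
  "surface_area_measure P = dirac_comb (facet_normals P) (\<lambda>u. area (face_in_direction P u))"

definition minkowski_polytope :: "(real^'n) set \<Rightarrow> (real^'n) set \<Rightarrow> bool" where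
  "minkowski_polytope X P \<longleftrightarrow>
     polytope P \<and> aff_dim P = int CARD('n) \<and>
     surface_area_measure P =
       dirac_comb X (\<lambda>_. area (sphere 0 1 :: (real^'n) set) / of_nat (card X))"

definition steiner_point :: "(real^'n) set \<Rightarrow> real^'n" where
  "steiner_point P = real CARD('n) *\<^sub>R (LINT u|sphere_measure. support_fun P u *\<^sub>R u)"

end

theory Submission
  imports Defs
begin

text \<open>
  Atoms of the surface area measure are the facet areas, and these are positive: summed with a unit
  segment transversal to it, a facet of area zero would become a Lebesgue null set, because a covering
  set of diameter \<open>D \<le> 1\<close> turns into a box of volume at most \<open>3 \<cdot> (2D) ^ (d - 1)\<close>. Hence every facet
  normal lies in \<open>X\<close> and \<open>P\<close> is cut out by the inequalities \<open>\<langle>x\<^sub>j, z\<rangle> \<le> h\<close>. Self-polarity puts the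
  points \<open>y\<^sub>j\<close> into \<open>P\<close>, which bounds every \<open>\<langle>U x\<^sub>i, x\<^sub>j\<rangle>\<close> by \<open>\<alpha>\<close>. If all these products were at
  most some positive \<open>m < \<alpha>\<close> for a fixed \<open>i\<close>, then \<open>(h / m) U x\<^sub>i\<close> would lie in \<open>P\<close>, and pairing it with
  the polar \<open>c U P\<close> would give \<open>h\<^sub>P(x\<^sub>i) \<le> m / (c h) < h\<close>.
\<close>

section \<open>Positivity of facet areas\<close>

lemma negligible_thickening:
  fixes A :: "(real^'n) set" and k :: 'n
  assumes "area A = 0"
  shows "negligible (\<Union>a\<in>A. \<Union>v\<in>closed_segment 0 (axis k 1). {a + v})"
    (is "negligible ?T")
proof (rule negligible_outer[THEN iffD2], intro allI impI)
  fix e :: real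
  assume e: "e > 0"
  define K where "K = unit_ball_vol (real (CARD('n) - 1))"
  \<comment> \<open>The box around a set of diameter \<open>D\<close> has sides
    \<open>2 * D\<close>, except one of length \<open>2 * D + 1\<close>, at most 3. Since
    \<open>2 * D = 4 * (D / 2)\<close>, this \<open>M\<close> turns the Hausdorff weight of the set
    into a bound for the box volume.\<close>
  define M where "M = 3 * 4 ^ (CARD('n) - 1) / K"
  have K: "K > 0" by (simp add: K_def)
  then have M: "M > 0" by (simp add: M_def)
  define \<tau> where "\<tau> = (\<lambda>S :: (real^'n) set. if S = {} then 0
      else ennreal (K * (diameter S / 2) ^ (CARD('n) - 1)))"
  have "hausdorff_pre (CARD('n) - 1) 1 A \<le> area A"
    unfolding area_def hausdorff_def by (rule SUP_upper) simp
  then have "hausdorff_pre (CARD('n) - 1) 1 A < ennreal (e / M)"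
    using assms e M by simp
  then obtain C :: "nat \<Rightarrow> (real^'n) set"
    where C: "A \<subseteq> (\<Union>n. C n)" "\<And>n. bounded (C n)" "\<And>n. diameter (C n) \<le> 1"
      and sum: "(\<Sum>n. \<tau> (C n)) < ennreal (e / M)"
    unfolding hausdorff_pre_def INF_less_iff \<tau>_def K_def by auto
  \<comment> \<open>A set lies within its diameter of any of its points, coordinate by coordinate;
    the extra 1 in direction \<open>k\<close> makes room for the segment. For empty
    \<open>C n\<close> the point is arbitrary and the box is dropped, matching the zero weight in
    \<open>\<tau>\<close>.\<close>
  define p where "p n = (SOME q. q \<in> C n)" for n
  define lo where "lo n = (\<chi> i. p n $ i - diameter (C n))" for n
  define hi where "hi n = (\<chi> i. p n $ i + diameter (C n) + (if i = k then 1 else 0))" for n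
  define B where "B n = (if C n = {} then {} else cbox (lo n) (hi n))" for n
  have B_vol: "emeasure lebesgue (B n) \<le> ennreal M * \<tau> (C n)" for n
  proof (cases "C n = {}")
    case False
    define D where "D = diameter (C n)"
    have D: "0 \<le> D" "D \<le> 1"
      using C(2,3)[of n] by (simp_all add: D_def diameter_ge_0)
    have "emeasure lebesgue (B n) = ennreal (\<Prod>i\<in>UNIV. hi n $ i - lo n $ i)"
      using False D
      by (simp add: B_def emeasure_eq_measure2 content_cbox_if_cart lo_def hi_def D_def[symmetric]
          interval_eq_empty_cart not_less)
    also have "(\<Prod>i\<in>UNIV. hi n $ i - lo n $ i) = (\<Prod>i\<in>UNIV. if i = k then 2 * D + 1 else 2 * D)"
      by (rule prod.cong) (auto simp: lo_def hi_def D_def)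
    also have "\<dots> = (2 * D + 1) * (2 * D) ^ (CARD('n) - 1)"
      by (subst prod.remove[of _ k]) (simp_all add: card_Diff_singleton)
    also have "\<dots> \<le> 3 * (2 * D) ^ (CARD('n) - 1)"
      using D by (intro mult_right_mono) auto
    also have "\<dots> = M * (K * (D / 2) ^ (CARD('n) - 1))"
    proof -
      have "(2 * D) ^ (CARD('n) - 1) = (4 * (D / 2)) ^ (CARD('n) - 1)"
        by simp
      then show ?thesis
        using K unfolding M_def power_mult_distrib[of 4] by simp
    qed
    also have "ennreal \<dots> = ennreal M * \<tau> (C n)"
      using False M by (simp add: \<tau>_def D_def ennreal_mult')
    finally show ?thesis by (simp add: ennreal_leI)
  qed (simp add: B_def)
  define T where "T = (\<Union>n. B n)"
  have B_sets: "range B \<subseteq> sets lebesgue"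
    by (auto simp: B_def)
  have "emeasure lebesgue T \<le> (\<Sum>n. emeasure lebesgue (B n))"
    unfolding T_def by (rule emeasure_subadditive_countably[OF B_sets])
  also have "\<dots> \<le> (\<Sum>n. ennreal M * \<tau> (C n))"
    by (intro suminf_le B_vol) auto
  also have "\<dots> = ennreal M * (\<Sum>n. \<tau> (C n))"
    by simp
  also have "\<dots> < ennreal M * ennreal (e / M)"
    using sum M by (intro ennreal_mult_strict_left_mono) auto
  also have "\<dots> = ennreal e"
    using M e by (simp flip: ennreal_mult)
  finally have T_small: "emeasure lebesgue T < ennreal e" .
  have "T \<in> sets lebesgue"
    unfolding T_def using B_sets by (intro sets.countable_UN) auto
  moreover have "T \<in> lmeasurable"
    using calculation T_small by (intro fmeasurableI) (auto intro: less_trans)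
  moreover have "measure lebesgue T < e"
    using T_small calculation e by (simp add: emeasure_eq_measure2 ennreal_less_iff)
  moreover have "?T \<subseteq> T"
  proof clarify
    fix a v
    assume a: "a \<in> A" and v: "v \<in> closed_segment 0 (axis k (1::real))"
    from a C(1) obtain n where n: "a \<in> C n" by auto
    then have "p n \<in> C n" unfolding p_def by (rule someI)
    then have "dist a (p n) \<le> diameter (C n)"
      using n C(2) by (intro diameter_bounded_bound)
    then have "\<bar>a $ i - p n $ i\<bar> \<le> diameter (C n)" for i
      using component_le_norm_cart[of "a - p n" i] by (simp add: dist_norm)
    then have near: "a $ i \<le> p n $ i + diameter (C n)" "p n $ i - diameter (C n) \<le> a $ i" for i
      by (simp_all add: abs_le_iff algebra_simps)
    from v obtain s where s: "0 \<le> s" "s \<le> 1" "v = s *\<^sub>R axis k 1"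
      by (auto simp: closed_segment_def)
    have "a + v \<in> cbox (lo n) (hi n)"
      using near s by (auto simp: mem_box_cart lo_def hi_def axis_def intro: add_increasing2 add_mono)
    then show "a + v \<in> T"
      using n by (auto simp: T_def B_def)
  qed
  ultimately show "\<exists>T. ?T \<subseteq> T \<and> T \<in> lmeasurable \<and> measure lebesgue T < e"
    by blast
qed

lemma interior_nonempty_of_full_aff_dim:
  fixes S :: "'a::euclidean_space set"
  assumes "convex S" and "aff_dim S = int DIM('a)"
  shows "interior S \<noteq> {}"
proof -
  have "S \<noteq> {}"
    using assms(2) by auto
  then have "rel_interior S \<noteq> {}"
    using assms(1) by (simp add: rel_interior_eq_empty)
  then show ?thesis
    using assms(2) by (simp add: rel_interior_interior aff_dim_eq_full)
qed

lemma area_pos_of_codim_one: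
  fixes A :: "(real^'n) set"
  assumes "convex A" and "aff_dim A = int CARD('n) - 1"
    and "u \<noteq> 0" and "A \<subseteq> {z. u \<bullet> z = b}"
  shows "area A \<noteq> 0"
proof
  assume "area A = 0"
  \<comment> \<open>The axis \<open>k\<close> leaves the hyperplane containing \<open>A\<close>, so
    adding the segment raises the affine dimension to full.\<close>
  from \<open>u \<noteq> 0\<close> obtain k where k: "u $ k \<noteq> 0"
    by (auto simp: vec_eq_iff)
  define T where "T = (\<Union>a\<in>A. \<Union>v\<in>closed_segment 0 (axis k 1). {a + v})"
  have "A \<noteq> {}"
    using assms(2) by auto
  then obtain a where a: "a \<in> A" by auto
  have convT: "convex T"
    unfolding T_def by (intro convex_sums assms(1) convex_closed_segment)
  have "A \<subseteq> T"
    unfolding T_def by force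
  moreover have "a + axis k 1 \<in> T"
    unfolding T_def using a by auto
  ultimately have "aff_dim (insert (a + axis k 1) A) \<le> aff_dim T"
    by (intro aff_dim_subset) auto
  moreover have "a + axis k 1 \<notin> affine hull A"
  proof
    assume "a + axis k 1 \<in> affine hull A"
    moreover have "affine hull A \<subseteq> {z. u \<bullet> z = b}"
      using assms(4) by (intro hull_minimal affine_hyperplane)
    ultimately show False
      using a assms(4) k by (fastforce simp: inner_add_right inner_axis)
  qed
  ultimately have "aff_dim T = int CARD('n)"
    using assms(2) aff_dim_le_DIM[of T] by (simp add: aff_dim_insert)
  then have "interior T \<noteq> {}"
    using interior_nonempty_of_full_aff_dim[OF convT] by simp
  moreover have "negligible T"
    unfolding T_def by (rule negligible_thickening) fact+
  ultimately show False
    using negligible_convex_interior[OF convT] by simp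
qed

section \<open>Facet normals of the Minkowski polytope\<close>

lemma emeasure_dirac_comb_singleton:
  "emeasure (dirac_comb A w) {u} = (if u \<in> A then w u else 0)"
proof -
  \<comment> \<open>At most one point survives the intersection, so the finite-sum formula applies
    even for infinite \<open>A\<close>.\<close>
  have "emeasure (dirac_comb A w) {u} = emeasure (point_measure A w) ({u} \<inter> A)"
    unfolding dirac_comb_def
    by (subst emeasure_distr) (auto simp: space_point_measure measurable_def sets_point_measure)
  also have "\<dots> = (\<Sum>a | a \<in> {u} \<inter> A \<and> 0 < w a. w a)"
    by (rule emeasure_point_measure) auto
  also have "{a. a \<in> {u} \<inter> A \<and> 0 < w a} = (if u \<in> A \<and> 0 < w u then {u} else {})"
    by auto
  finally show ?thesis
    by (auto simp: zero_less_iff_neq_zero split: if_splits)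
qed

lemma facet_normals_subset:
  fixes X P :: "(real^'n) set"
  assumes "minkowski_polytope X P"
  shows "facet_normals P \<subseteq> X"
proof
  fix u
  assume u: "u \<in> facet_normals P"
  define F where "F = face_in_direction P u"
  have P: "polytope P" "aff_dim P = int CARD('n)"
    and eq: "surface_area_measure P =
      dirac_comb X (\<lambda>_. area (sphere 0 1 :: (real^'n) set) / of_nat (card X))"
    using assms by (auto simp: minkowski_polytope_def)
  have F: "F facet_of P" and "u \<noteq> 0"
    using u by (auto simp: F_def facet_normals_def)
  have "area F \<noteq> 0"
  proof (rule area_pos_of_codim_one)
    show "convex F"
      using F facet_of_imp_face_of face_of_imp_convex by blast
    show "aff_dim F = int CARD('n) - 1"
      using F P by (simp add: facet_of_def)
    show "F \<subseteq> {z. u \<bullet> z = support_fun P u}"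
      by (auto simp: F_def face_in_direction_def)
  qed fact+
  moreover have "emeasure (surface_area_measure P) {u} = area F"
    using u by (simp add: surface_area_measure_def emeasure_dirac_comb_singleton F_def)
  ultimately show "u \<in> X"
    by (auto simp: eq emeasure_dirac_comb_singleton split: if_splits)
qed

section \<open>Support numbers, facet inequalities and the polar\<close>

lemma le_support_fun:
  assumes "bounded P" and "z \<in> P"
  shows "u \<bullet> z \<le> support_fun P u"
proof -
  have "bounded ((\<bullet>) u ` P)"
    by (rule bounded_linear_image[OF assms(1) bounded_linear_inner_right])
  then show ?thesis
    unfolding support_fun_def using assms(2) by (intro cSUP_upper bounded_imp_bdd_above)
qed

lemma support_fun_pos:
  assumes "bounded P" and "0 \<in> interior P" and "u \<noteq> 0"
  shows "support_fun P u > 0"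
proof -
  obtain e where e: "e > 0" "cball 0 e \<subseteq> P"
    using assms(2) by (auto simp: mem_interior_cball)
  then have "(e / norm u) *\<^sub>R u \<in> P"
    using assms(3) by (auto simp: subset_iff)
  then have "u \<bullet> (e / norm u) *\<^sub>R u \<le> support_fun P u"
    by (rule le_support_fun[OF assms(1)])
  moreover have "0 < u \<bullet> (e / norm u) *\<^sub>R u"
    using e(1) assms(3) by simp
  ultimately show ?thesis by linarith
qed

text \<open>Rescale the normal of a halfspace that cuts out the facet; since the facet is nonempty,
  the rescaled bound is attained and equals the support number.\<close>

lemma facet_normal_of_facet:
  fixes P :: "(real^'n) set"
  assumes "polytope P" and "aff_dim P = int CARD('n)" and "F facet_of P"
  obtains u where "u \<in> facet_normals P" and "F = face_in_direction P u"
proof -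
  obtain a b where a: "a \<noteq> 0" "P \<subseteq> {z. a \<bullet> z \<le> b}" "F = P \<inter> {z. a \<bullet> z = b}"
    using facet_of_polyhedron[OF polytope_imp_polyhedron[OF assms(1)] assms(3)] by metis
  define u where "u = (1 / norm a) *\<^sub>R a"
  obtain f where f: "f \<in> F"
    using assms(3) by (auto simp: facet_of_def)
  have "support_fun P u = b / norm a"
    unfolding support_fun_def
  proof (rule cSup_eq_maximum)
    show "b / norm a \<in> (\<bullet>) u ` P"
      using f a by (auto simp: u_def image_iff intro!: bexI[of _ f])
    show "z \<le> b / norm a" if "z \<in> (\<bullet>) u ` P" for z
      using that a by (auto simp: u_def intro!: divide_right_mono)
  qed
  then have "F = face_in_direction P u"
    using a by (auto simp: face_in_direction_def u_def)
  moreover have "norm u = 1"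
    using a(1) by (simp add: u_def)
  ultimately show ?thesis
    using assms(3) that[of u] by (simp add: facet_normals_def)
qed

text \<open>Otherwise the segment from 0 to \<open>z\<close> leaves \<open>P\<close> at some
  \<open>s *\<^sub>R z\<close> with \<open>s < 1\<close>, on a facet with normal \<open>u\<close>.
  There \<open>s * (u \<bullet> z)\<close> equals the positive support number, while the inequality
  for \<open>u\<close> makes it strictly smaller.\<close>

lemma mem_of_facet_inequalities:
  fixes P :: "(real^'n) set"
  assumes "polytope P" and "aff_dim P = int CARD('n)" and "0 \<in> interior P"
    and "\<And>u. u \<in> facet_normals P \<Longrightarrow> u \<bullet> z \<le> support_fun P u"
  shows "z \<in> P"
proof (rule ccontr)
  assume "z \<notin> P"
  have P: "bounded P" "closed P"
    using assms(1) polytope_imp_bounded polytope_imp_closed by auto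
  have "closed_segment 0 z \<inter> frontier P \<noteq> {}"
    using \<open>z \<notin> P\<close> assms(3) interior_subset
    by (intro connected_Int_frontier) (auto intro: connected_segment)
  then obtain s where s: "0 \<le> s" "s \<le> 1" and front: "s *\<^sub>R z \<in> frontier P"
    by (auto simp: closed_segment_def)
  have "s *\<^sub>R z \<in> P" "s *\<^sub>R z \<notin> interior P"
    using front P(2) by (auto simp: frontier_def)
  then have "s \<noteq> 1" "s \<noteq> 0"
    using \<open>z \<notin> P\<close> assms(3) by auto
  have "P - rel_interior P = \<Union>{F. F facet_of P}"
    by (rule rel_boundary_of_polyhedron[OF polytope_imp_polyhedron[OF assms(1)]])
  moreover have "rel_interior P = interior P"
    using assms(3) by (intro rel_interior_nonempty_interior) auto
  ultimately obtain F where F: "F facet_of P" "s *\<^sub>R z \<in> F"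
    using \<open>s *\<^sub>R z \<in> P\<close> \<open>s *\<^sub>R z \<notin> interior P\<close> by auto
  then obtain u where u: "u \<in> facet_normals P" "F = face_in_direction P u"
    using facet_normal_of_facet[OF assms(1,2)] by metis
  then have "u \<noteq> 0"
    by (auto simp: facet_normals_def)
  then have pos: "support_fun P u > 0"
    using P(1) assms(3) by (rule support_fun_pos[rotated 2])
  have "s * (u \<bullet> z) = support_fun P u"
    using F(2) u(2) by (simp add: face_in_direction_def)
  moreover have "s * (u \<bullet> z) \<le> s * support_fun P u"
    using assms(4)[OF u(1)] s(1) by (rule mult_left_mono)
  moreover have "s * support_fun P u < 1 * support_fun P u"
    using s \<open>s \<noteq> 1\<close> pos by (intro mult_strict_right_mono) auto
  ultimately show False by simp
qed

text \<open>If 0 is not interior, a separating hyperplane yields \<open>a \<noteq> 0\<close> with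
  \<open>a \<bullet> z \<le> 0\<close> on \<open>P\<close>; the whole ray through \<open>a\<close>
  then lies in the polar.\<close>

lemma zero_in_interior_of_bounded_polar:
  fixes P :: "(real^'n) set"
  assumes "closed P" and "convex P" and "interior P \<noteq> {}" and "bounded (polar P)"
  shows "0 \<in> interior P"
proof (rule ccontr)
  assume "0 \<notin> interior P"
  then obtain a b where a: "a \<noteq> 0" "\<forall>z\<in>interior P. a \<bullet> z \<le> b" "\<forall>z\<in>{0}. b \<le> a \<bullet> z"
    using separating_hyperplane_sets[of "interior P" "{0}"] assms(2,3)
    by (auto simp: convex_interior)
  have "interior P \<subseteq> {z. a \<bullet> z \<le> 0}"
    using a by auto
  then have "closure (interior P) \<subseteq> {z. a \<bullet> z \<le> 0}"
    by (intro closure_minimal closed_halfspace_le)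
  then have neg: "a \<bullet> z \<le> 0" if "z \<in> P" for z
    using that assms(1-3) by (auto simp: convex_closure_interior)
  obtain B where B: "\<And>z. z \<in> polar P \<Longrightarrow> norm z \<le> B"
    using assms(4) by (auto simp: bounded_iff)
  \<comment> \<open>Chosen so that \<open>s *\<^sub>R a\<close> has norm
    \<open>\<bar>B\<bar> + 1\<close>, beyond the bound \<open>B\<close>.\<close>
  define s where "s = (\<bar>B\<bar> + 1) / norm a"
  have "s \<ge> 0" by (simp add: s_def)
  then have "s * (a \<bullet> z) \<le> 1" if "z \<in> P" for z
    using mult_nonneg_nonpos[OF _ neg[OF that], of s] by simp
  then have "s *\<^sub>R a \<in> polar P"
    by (simp add: polar_def)
  from B[OF this] show False
    using a(1) by (simp add: s_def)
qed

section \<open>Inner products under self-polarity\<close>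

theorem proposition5p3:
  fixes x y :: "nat \<Rightarrow> real^'n" and X P :: "(real^'n) set" and F :: "nat \<Rightarrow> (real^'n) set"
    and U :: "real^'n^'n" and c h r R \<alpha> :: real and t N :: nat
  assumes "CARD('n) \<ge> 2" and "t \<ge> 2"
    and "bij_betw x {1..N} X"
    and "spherical_design t X" and "node_transitive X"
    and "minkowski_polytope X P" and "steiner_point P = 0"
    and "c > 0" and "orthogonal_matrix U"
    and "polar P = (\<lambda>v. c *\<^sub>R (U *v v)) ` P"
    and "\<forall>i\<in>{1..N}. support_fun P (x i) = h"
    and "r = h" and "R = 1 / (c * h)" and "\<alpha> = c * h\<^sup>2"
    and "\<forall>i\<in>{1..N}. F i = face_in_direction P (x i)"
    and "\<forall>j\<in>{1..N}. y j = (1 / (c * h)) *\<^sub>R (transpose U *v x j)"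
  shows "\<alpha> = r / R \<and>
    (\<forall>i\<in>{1..N}. \<alpha> = Max ((\<lambda>j. (U *v x i) \<bullet> x j) ` {1..N})) \<and>
    (\<forall>i\<in>{1..N}. \<forall>j\<in>{1..N}. y j \<in> F i \<longleftrightarrow> (U *v x i) \<bullet> x j = \<alpha>)"
proof -
  have P: "polytope P" "aff_dim P = int CARD('n)"
    using assms(6) by (auto simp: minkowski_polytope_def)
  then have P': "bounded P" "closed P" "convex P" "P \<noteq> {}"
    by (auto simp: polytope_imp_bounded polytope_imp_closed polytope_imp_convex)
  have U: "(U *v v) \<bullet> (U *v w) = v \<bullet> w" for v w
    using assms(9) by (metis orthogonal_transformation_def orthogonal_transformation_matrix
        matrix_of_matrix_vector_mul matrix_vector_mul_linear)
  \<comment> \<open>Self-polarity makes the polar a linear image of the bounded set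
    \<open>P\<close>, which places 0 in the interior.\<close>
  have "bounded (polar P)"
    unfolding assms(10)
    by (intro bounded_linear_image[OF P'(1)] bounded_linear_const_scaleR matrix_vector_mul_bounded_linear)
  moreover have "interior P \<noteq> {}"
    using interior_nonempty_of_full_aff_dim[OF P'(3)] P(2) by simp
  ultimately have int: "0 \<in> interior P"
    using P' by (intro zero_in_interior_of_bounded_polar)
  have X: "X = x ` {1..N}"
    using assms(3) by (simp add: bij_betw_def)
  \<comment> \<open>An index is required because \<open>h\<close> is tied to \<open>P\<close> only
    through the points \<open>x i\<close>.\<close>
  have h: "h > 0" if "i \<in> {1..N}" for i
  proof -
    have "norm (x i) = 1"
      using that X assms(4) by (force simp: spherical_design_def)
    then show ?thesis
      using support_fun_pos[OF P'(1) int, of "x i"] assms(11) that by force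
  qed
  have le: "x i \<bullet> z \<le> h" if "i \<in> {1..N}" "z \<in> P" for i z
    using le_support_fun[OF P'(1) that(2), of "x i"] assms(11) that(1) by simp
  have mem: "z \<in> P" if "\<And>j. j \<in> {1..N} \<Longrightarrow> x j \<bullet> z \<le> h" for z
  proof (rule mem_of_facet_inequalities[OF P int])
    fix u
    assume "u \<in> facet_normals P"
    then have "u \<in> X"
      using facet_normals_subset[OF assms(6)] by auto
    then show "u \<bullet> z \<le> support_fun P u"
      using that assms(11) unfolding X by auto
  qed
  have y_inner: "x i \<bullet> y j = ((U *v x i) \<bullet> x j) / (c * h)" if "j \<in> {1..N}" for i j
    using assms(16) that by (simp add: dot_lmul_matrix[symmetric] inner_commute)
  have y_mem: "y j \<in> P" if j: "j \<in> {1..N}" for j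
  proof -
    \<comment> \<open>The facet inequality for \<open>x j\<close> says exactly this. Its preimage in
      \<open>P\<close> under \<open>c U\<close> is \<open>y j\<close>, as the transpose inverts
      \<open>U\<close>.\<close>
    have "(1 / h) *\<^sub>R x j \<in> polar P"
      using le[OF j] h[OF j] by (auto simp: polar_def field_simps)
    then obtain p where p: "p \<in> P" "(1 / h) *\<^sub>R x j = c *\<^sub>R (U *v p)"
      using assms(10) by auto
    have "transpose U *v ((1 / h) *\<^sub>R x j) = c *\<^sub>R p"
      using assms(9) unfolding p(2) orthogonal_matrix_def
      by (simp add: matrix_vector_mult_scaleR matrix_vector_mul_assoc)
    then have "y j = (1 / c) *\<^sub>R (c *\<^sub>R p)"
      using assms(16) j by (simp add: matrix_vector_mult_scaleR flip: \<open>_ = c *\<^sub>R p\<close>)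
    then show ?thesis
      using p(1) assms(8) by simp
  qed
  have upper: "(U *v x i) \<bullet> x j \<le> \<alpha>" if "i \<in> {1..N}" "j \<in> {1..N}" for i j
    using le[OF that(1) y_mem[OF that(2)]] h[OF that(1)] assms(8)
    by (simp add: y_inner[OF that(2)] assms(14) power2_eq_square field_simps)
  have attained: "\<alpha> \<le> Max ((\<lambda>j. (U *v x i) \<bullet> x j) ` {1..N})" (is "_ \<le> ?M") if i: "i \<in> {1..N}" for i
  proof (rule ccontr)
    assume "\<not> \<alpha> \<le> ?M"
    moreover have "\<alpha> > 0"
      using h[OF i] assms(8,14) by simp
    \<comment> \<open>The 0 keeps \<open>m\<close> positive, so that \<open>h / m\<close> is a
      legitimate scaling even if \<open>?M\<close> is negative.\<close>
    ultimately obtain m where m: "max 0 ?M < m" "m < \<alpha>"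
      using dense[of "max 0 ?M" \<alpha>] by auto
    have "(h / m) *\<^sub>R (U *v x i) \<in> P"
    proof (rule mem)
      fix j
      assume "j \<in> {1..N}"
      then have "(U *v x i) \<bullet> x j \<le> ?M"
        by (intro Max_ge) auto
      then show "x j \<bullet> (h / m) *\<^sub>R (U *v x i) \<le> h"
        using m h[OF i] by (simp add: inner_commute field_simps)
    qed
    moreover have "c *\<^sub>R (U *v p) \<in> polar P" if "p \<in> P" for p
      using that assms(10) by auto
    ultimately have "(c *\<^sub>R (U *v p)) \<bullet> ((h / m) *\<^sub>R (U *v x i)) \<le> 1" if "p \<in> P" for p
      using that unfolding polar_def by blast
    \<comment> \<open>Both vectors carry a factor \<open>U\<close>, which cancels in the inner
      product by orthogonality.\<close>
    then have "x i \<bullet> p \<le> m / (c * h)" if "p \<in> P" for p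
      using that m h[OF i] assms(8) by (simp add: U inner_commute field_simps)
    then have "support_fun P (x i) \<le> m / (c * h)"
      unfolding support_fun_def using P'(4) by (intro cSUP_least)
    then have "h * (c * h) \<le> m"
      using assms(8,11) h[OF i] i by (simp add: pos_le_divide_eq)
    then show False
      using m(2) assms(14) by (simp add: power2_eq_square mult_ac)
  qed
  \<comment> \<open>Positivity of \<open>h\<close> is not at hand here without an index; for
    \<open>h = 0\<close> both sides are 0, as \<open>1 / 0 = 0\<close>.\<close>
  have "\<alpha> = r / R"
    using assms(12-14) by (simp add: power2_eq_square)
  moreover have "\<alpha> = Max ((\<lambda>j. (U *v x i) \<bullet> x j) ` {1..N})" if "i \<in> {1..N}" for i
    using that upper by (intro antisym attained Max.boundedI) auto
  \<comment> \<open>As \<open>y j\<close> is already in \<open>P\<close>, lying on the facet reduces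
    to \<open>x i \<bullet> y j = h\<close>; multiply by \<open>c * h\<close>.\<close>
  moreover have "y j \<in> F i \<longleftrightarrow> (U *v x i) \<bullet> x j = \<alpha>" if "i \<in> {1..N}" "j \<in> {1..N}" for i j
    using that y_mem assms(8,11,14,15) h[OF that(1)]
    by (auto simp: face_in_direction_def y_inner power2_eq_square field_simps)
  ultimately show ?thesis
    by blast
qed

end
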